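(* Let $\mathcal X$ be a $2$-coskeletal simplicial set equipped with a bijection $\hat\alpha:X_1\to X_1$, satisfying the following properties. (A1) The map $X_2\to (X_1)^3$, $\zeta\mapsto(d_2^2\zeta,d_0^2\zeta,d_1^2\zeta)$, is injective; identify $X_2$ with its image in $(X_1)^3$. (A2) For any $\zeta\in X_2$: if $d_0^2\zeta=s_0^0u$ for some $u\in X_0$, then $d_2^2\zeta=d_1^2\zeta$; and if $d_2^2\zeta=s_0^0u$ for some $u\in X_0$, then $d_0^2\zeta=d_1^2\zeta$. (B1) If $\zeta_0,\zeta_2\in X_2$ satisfy $d_0^2\zeta_2=d_1^2\zeta_0$, then there exists $\gamma\in X_3$ with $d_0^3\gamma=\zeta_0$ and $d_2^3\gamma=\zeta_2$. (B2) If $\zeta_1,\zeta_3\in X_2$ satisfy $d_1^2\zeta_3=d_2^2\zeta_1$, then there exists $\gamma\in X_3$ with $d_1^3\gamma=\zeta_1$ and $d_3^3\gamma=\zeta_3$. (C) $X_2\subseteq (X_1)^3$ is invariant under the $\mathbb Z$-action on $(X_1)^3$ generated by the bijection $(x,y,z)\mapsto(y,\hat\alpha(z),\hat\alpha(x))$. Set $X=X_1$, $\mu=X_2\subseteq X^3$, $\eta=s_0^0(X_0)\subseteq X$, $\epsilon=(\hat\alpha\circ s_0^0)(X_0)\subseteq X$, and $\delta=\{(y,\hat\alpha(x),z)\in X^3\mid (x,y,z)\in\mu\}\subseteq X^3$. Then $(X,\epsilon,\eta,\delta,\mu)$ is a Frobenius object in $\mathbf{Rel}$.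
   Context: In the category $\mathbf{Rel}$, objects are sets, a morphism $S:X\dashrightarrow Y$ is a subset $S\subseteq X\times Y$, composition is $T\circ S=\{(x,z)\mid \exists y:\ (x,y)\in S,\ (y,z)\in T\}$, the identity $\mathbf{1}$ is the diagonal, and $S\times T$ denotes the product relation (with $\{\bullet\}\times X\cong X\cong X\times\{\bullet\}$ identified). A Frobenius object in $\mathbf{Rel}$ is a set $X$ with morphisms $\epsilon:X\dashrightarrow\{\bullet\}$, $\eta:\{\bullet\}\dashrightarrow X$, $\delta:X\dashrightarrow X\times X$, $\mu:X\times X\dashrightarrow X$ such that (U) $\mu\circ(\eta\times\mathbf 1)=\mathbf 1=\mu\circ(\mathbf 1\times\eta)$; (C) $(\epsilon\times\mathbf 1)\circ\delta=\mathbf 1=(\mathbf 1\times\epsilon)\circ\delta$; (F) $(\mathbf 1\times\mu)\circ(\delta\times\mathbf 1)=\delta\circ\mu=(\mu\times\mathbf 1)\circ(\mathbf 1\times\delta)$. We view $\epsilon,\eta\subseteq X$ and $\delta,\mu\subseteq X^3$; $(x,y,z)\in\mu$ has inputs $x,y$ and output $z$; $(x,y,z)\in\delta$ has input $x$ and outputs $y,z$. A simplicial set is a sequence of sets $X_0,X_1,\dots$ with face maps $d_i^q:X_q\to X_{q-1}$ and degeneracy maps $s_i^q:X_q\to X_{q+1}$, $0\le i\le q$, satisfying $d_i^{q-1}d_j^q=d_{j-1}^{q-1}d_i^q$ for $i<j$; $s_i^{q+1}s_j^q=s_{j+1}^{q+1}s_i^q$ for $i\le j$; and $d_i^{q+1}s_j^q=s_{j-1}^{q-1}d_i^q$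 if $i<j$, $=\mathrm{id}$ if $i=j$ or $j+1$, $=s_j^{q-1}d_{i-1}^q$ if $i>j+1$. For $q\ge1$, $\Delta_q\mathcal X$ is the set of tuples $(\zeta_0,\dots,\zeta_q)$ in $X_{q-1}$ with $d_i^{q-1}\zeta_j=d_{j-1}^{q-1}\zeta_i$ for $i<j$ (no condition when $q=1$). $\mathcal X$ is $2$-coskeletal if for all $q>2$ the map $X_q\to\Delta_q\mathcal X$, $w\mapsto(d_0^qw,\dots,d_q^qw)$, is a bijection. *)

theory Defs
  imports Main "HOL-Library.FuncSet"
begin

section \<open>Frobenius objects in the category of sets and relations\<close>

definition rel_hom :: "'a set \<Rightarrow> 'b set \<Rightarrow> ('a \<times> 'b) set set" where
  "rel_hom X Y = Pow (X \<times> Y)"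

text \<open>The library's relation composition is in diagrammatic order; this is the usual order.\<close>

abbreviation rel_after :: "('b \<times> 'c) set \<Rightarrow> ('a \<times> 'b) set \<Rightarrow> ('a \<times> 'c) set"
    (infixr "\<circ>\<^sub>R" 55) where
  "T \<circ>\<^sub>R S \<equiv> S O T"

definition rel_times :: "('a \<times> 'c) set \<Rightarrow> ('b \<times> 'd) set \<Rightarrow> (('a \<times> 'b) \<times> ('c \<times> 'd)) set"
    (infixr "\<times>\<^sub>R" 70) where
  "S \<times>\<^sub>R T = {((a, b), (c, d)) | a b c d. (a, c) \<in> S \<and> (b, d) \<in> T}"

text \<open>The canonical bijections, as relations, behind the identifications of
  \<open>{()} \<times> X\<close> and \<open>X \<times> {()}\<close> with \<open>X\<close>, and of \<open>(X \<times> X) \<times> X\<close> with \<open>X \<times> (X \<times> X)\<close>;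
  the one-point set is the carrier of type \<open>unit\<close>.\<close>

definition lunit :: "'a set \<Rightarrow> ((unit \<times> 'a) \<times> 'a) set" where
  "lunit X = {(((), x), x) | x. x \<in> X}"

definition runit :: "'a set \<Rightarrow> (('a \<times> unit) \<times> 'a) set" where
  "runit X = {((x, ()), x) | x. x \<in> X}"

definition assoc :: "'a set \<Rightarrow> ((('a \<times> 'a) \<times> 'a) \<times> ('a \<times> ('a \<times> 'a))) set" where
  "assoc X = {(((x, y), z), (x, (y, z))) | x y z. x \<in> X \<and> y \<in> X \<and> z \<in> X}"

locale frobenius_object_Rel =
  fixes X :: "'a set"
    and \<epsilon> :: "('a \<times> unit) set"
    and \<eta> :: "(unit \<times> 'a) set"
    and \<delta> :: "('a \<times> ('a \<times> 'a)) set"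
    and \<mu> :: "(('a \<times> 'a) \<times> 'a) set"
  assumes counit_hom: "\<epsilon> \<in> rel_hom X {()}"
    and unit_hom: "\<eta> \<in> rel_hom {()} X"
    and comult_hom: "\<delta> \<in> rel_hom X (X \<times> X)"
    and mult_hom: "\<mu> \<in> rel_hom (X \<times> X) X"
    and left_unit: "\<mu> \<circ>\<^sub>R (\<eta> \<times>\<^sub>R Id_on X) \<circ>\<^sub>R (lunit X)\<inverse> = Id_on X"
    and right_unit: "\<mu> \<circ>\<^sub>R (Id_on X \<times>\<^sub>R \<eta>) \<circ>\<^sub>R (runit X)\<inverse> = Id_on X"
    and left_counit: "lunit X \<circ>\<^sub>R (\<epsilon> \<times>\<^sub>R Id_on X) \<circ>\<^sub>R \<delta> = Id_on X"
    and right_counit: "runit X \<circ>\<^sub>R (Id_on X \<times>\<^sub>R \<epsilon>) \<circ>\<^sub>R \<delta> = Id_on X"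
    and frobenius_left:
      "(Id_on X \<times>\<^sub>R \<mu>) \<circ>\<^sub>R assoc X \<circ>\<^sub>R (\<delta> \<times>\<^sub>R Id_on X) = \<delta> \<circ>\<^sub>R \<mu>"
    and frobenius_right:
      "(\<mu> \<times>\<^sub>R Id_on X) \<circ>\<^sub>R (assoc X)\<inverse> \<circ>\<^sub>R (Id_on X \<times>\<^sub>R \<delta>) = \<delta> \<circ>\<^sub>R \<mu>"

text \<open>Subsets of \<open>X\<close> and of \<open>X \<times> X \<times> X\<close> viewed as morphisms. As tuples nest to the right, a
  set of triples already is a relation with the first entry as input and the last two as outputs,
  so \<open>\<delta>\<close> needs no conversion.\<close>

definition as_counit :: "'a set \<Rightarrow> ('a \<times> unit) set" where
  "as_counit A = A \<times> {()}"

definition as_unit :: "'a set \<Rightarrow> (unit \<times> 'a) set" where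
  "as_unit A = {()} \<times> A"

definition as_mult :: "('a \<times> 'a \<times> 'a) set \<Rightarrow> (('a \<times> 'a) \<times> 'a) set" where
  "as_mult M = {((x, y), z) | x y z. (x, y, z) \<in> M}"


section \<open>Simplicial sets\<close>

text \<open>The face map \<open>d\<^sub>i\<^sup>q\<close> is \<open>d q i\<close> and the degeneracy map \<open>s\<^sub>i\<^sup>q\<close> is \<open>s q i\<close>. Only their values on
  \<open>X q\<close> for \<open>i \<le> q\<close> (and \<open>q \<ge> 1\<close> in the case of faces) are meaningful.\<close>

locale simplicial_set =
  fixes X :: "nat \<Rightarrow> 'a set"
    and d :: "nat \<Rightarrow> nat \<Rightarrow> 'a \<Rightarrow> 'a"
    and s :: "nat \<Rightarrow> nat \<Rightarrow> 'a \<Rightarrow> 'a"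
  assumes face_closed: "\<lbrakk>1 \<le> q; i \<le> q; x \<in> X q\<rbrakk> \<Longrightarrow> d q i x \<in> X (q - 1)"
    and degen_closed: "\<lbrakk>i \<le> q; x \<in> X q\<rbrakk> \<Longrightarrow> s q i x \<in> X (q + 1)"
    and face_face: "\<lbrakk>2 \<le> q; i < j; j \<le> q; x \<in> X q\<rbrakk>
          \<Longrightarrow> d (q - 1) i (d q j x) = d (q - 1) (j - 1) (d q i x)"
    and degen_degen: "\<lbrakk>i \<le> j; j \<le> q; x \<in> X q\<rbrakk>
          \<Longrightarrow> s (q + 1) i (s q j x) = s (q + 1) (j + 1) (s q i x)"
    and face_degen_less: "\<lbrakk>i < j; j \<le> q; x \<in> X q\<rbrakk>
          \<Longrightarrow> d (q + 1) i (s q j x) = s (q - 1) (j - 1) (d q i x)"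
    and face_degen_id: "\<lbrakk>i = j \<or> i = j + 1; j \<le> q; x \<in> X q\<rbrakk>
          \<Longrightarrow> d (q + 1) i (s q j x) = x"
    and face_degen_greater: "\<lbrakk>j + 1 < i; i \<le> q + 1; x \<in> X q\<rbrakk>
          \<Longrightarrow> d (q + 1) i (s q j x) = s (q - 1) j (d q (i - 1) x)"

text \<open>Meant for \<open>q \<ge> 1\<close>. A tuple \<open>(\<zeta>\<^sub>0, \<dots>, \<zeta>\<^sub>q)\<close> is an extensional function on \<open>{..q}\<close>.\<close>

definition simplicial_boundary ::
    "(nat \<Rightarrow> 'a set) \<Rightarrow> (nat \<Rightarrow> nat \<Rightarrow> 'a \<Rightarrow> 'a) \<Rightarrow> nat \<Rightarrow> (nat \<Rightarrow> 'a) set" where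
  "simplicial_boundary X d q =
     {\<zeta> \<in> {..q} \<rightarrow>\<^sub>E X (q - 1).
        2 \<le> q \<longrightarrow> (\<forall>i j. i < j \<and> j \<le> q \<longrightarrow> d (q - 1) i (\<zeta> j) = d (q - 1) (j - 1) (\<zeta> i))}"

definition two_coskeletal ::
    "(nat \<Rightarrow> 'a set) \<Rightarrow> (nat \<Rightarrow> nat \<Rightarrow> 'a \<Rightarrow> 'a) \<Rightarrow> bool" where
  "two_coskeletal X d \<longleftrightarrow>
     (\<forall>q > 2. bij_betw (\<lambda>w. \<lambda>i\<in>{..q}. d q i w) (X q) (simplicial_boundary X d q))"

definition edges :: "(nat \<Rightarrow> nat \<Rightarrow> 'a \<Rightarrow> 'a) \<Rightarrow> 'a \<Rightarrow> 'a \<times> 'a \<times> 'a" where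
  "edges d \<zeta> = (d 2 2 \<zeta>, d 2 0 \<zeta>, d 2 1 \<zeta>)"


section \<open>Integer actions generated by a bijection\<close>

text \<open>The \<open>n\<close>-th power of a bijection \<open>f\<close> of \<open>A\<close>, for an arbitrary integer \<open>n\<close>.\<close>

definition int_power_on :: "'b set \<Rightarrow> ('b \<Rightarrow> 'b) \<Rightarrow> int \<Rightarrow> 'b \<Rightarrow> 'b" where
  "int_power_on A f n = (if 0 \<le> n then f ^^ nat n else (inv_into A f) ^^ nat (- n))"

definition int_invariant :: "'b set \<Rightarrow> ('b \<Rightarrow> 'b) \<Rightarrow> 'b set \<Rightarrow> bool" where
  "int_invariant A f T \<longleftrightarrow> (\<forall>n. \<forall>t \<in> T. int_power_on A f n t \<in> T)"

definition rotate_triple :: "('a \<Rightarrow> 'a) \<Rightarrow> 'a \<times> 'a \<times> 'a \<Rightarrow> 'a \<times> 'a \<times> 'a" where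
  "rotate_triple \<alpha> = (\<lambda>(x, y, z). (y, \<alpha> z, \<alpha> x))"

end

theory Submission
  imports Defs
begin

text \<open>Read \<open>(x, y, z) \<in> \<mu>\<close> as ``\<open>z\<close> is a value of the product of \<open>x\<close> and \<open>y\<close>''. Degenerate
  2-simplices together with (A2) make \<open>s\<^sub>0(X\<^sub>0)\<close> a set of units, and the four faces of a
  3-simplex \<open>0123\<close> turn (B1) and (B2) into the two halves of associativity: its faces \<open>123\<close> and
  \<open>013\<close> compute \<open>x(yz)\<close>, its faces \<open>012\<close> and \<open>023\<close> compute \<open>(xy)z\<close>. By (C), a triple
  \<open>(a, b, c)\<close> lies in \<open>\<delta>\<close> iff \<open>(\<alpha>\<^sup>-\<^sup>1(b), a, c) \<in> \<mu>\<close> iff \<open>(a, \<alpha>(c), b) \<in> \<mu>\<close>; the first form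
  reduces one Frobenius equation to associativity, the second form the other one.\<close>

lemma rel_times_iff: "((a, b), (c, d)) \<in> S \<times>\<^sub>R T \<longleftrightarrow> (a, c) \<in> S \<and> (b, d) \<in> T"
  by (simp add: rel_times_def)

lemma rel_coherence_iff:
  "((u, x), y) \<in> lunit A \<longleftrightarrow> x = y \<and> x \<in> A"
  "((x, u), y) \<in> runit A \<longleftrightarrow> x = y \<and> x \<in> A"
  "(((x, y), z), (x', y', z')) \<in> assoc A \<longleftrightarrow>
     x = x' \<and> y = y' \<and> z = z' \<and> x \<in> A \<and> y \<in> A \<and> z \<in> A"
  by (auto simp: lunit_def runit_def assoc_def)

lemma as_morphism_iff:
  "((x, y), z) \<in> as_mult M \<longleftrightarrow> (x, y, z) \<in> M"
  "(u, x) \<in> as_unit E \<longleftrightarrow> x \<in> E"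
  "(x, u) \<in> as_counit E \<longleftrightarrow> x \<in> E"
  by (auto simp: as_mult_def as_unit_def as_counit_def)

text \<open>Isolates the relational algebra: all that a simplicial set has to supply is units,
  associativity of a multivalued product, and \<open>rotate\<close>, the generator of the Z-action
  in elementwise form.\<close>

lemma frobenius_object_of_rotation_invariant_monoid:
  fixes A E :: "'a set" and M :: "('a \<times> 'a \<times> 'a) set" and \<alpha> :: "'a \<Rightarrow> 'a"
  defines "D \<equiv> {(y, \<alpha> x, z) | x y z. (x, y, z) \<in> M}"
  assumes M: "M \<subseteq> A \<times> A \<times> A" and E: "E \<subseteq> A" and bij: "bij_betw \<alpha> A A"
    and unit_left: "\<And>x z. x \<in> A \<Longrightarrow> z \<in> A \<Longrightarrow> (\<exists>e\<in>E. (e, x, z) \<in> M) \<longleftrightarrow> x = z"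
    and unit_right: "\<And>x z. x \<in> A \<Longrightarrow> z \<in> A \<Longrightarrow> (\<exists>e\<in>E. (x, e, z) \<in> M) \<longleftrightarrow> x = z"
    and assoc: "\<And>x y z w. (\<exists>u. (x, y, u) \<in> M \<and> (u, z, w) \<in> M) \<longleftrightarrow>
                           (\<exists>v. (y, z, v) \<in> M \<and> (x, v, w) \<in> M)"
    and rotate: "\<And>x y z. x \<in> A \<Longrightarrow> y \<in> A \<Longrightarrow> z \<in> A \<Longrightarrow>
                   (y, \<alpha> z, \<alpha> x) \<in> M \<longleftrightarrow> (x, y, z) \<in> M"
  shows "frobenius_object_Rel A (as_counit (\<alpha> ` E)) (as_unit E) D (as_mult M)"
proof -
  have \<alpha>A: "\<alpha> x \<in> A" if "x \<in> A" for x
    using bij that by (auto simp: bij_betw_def)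
  have \<alpha>_inj: "x = y" if "\<alpha> x = \<alpha> y" "x \<in> A" "y \<in> A" for x y
    using bij that by (auto simp: bij_betw_def inj_on_def)
  have \<alpha>_surj: "\<exists>x\<in>A. y = \<alpha> x" if "y \<in> A" for y
    using bij that by (auto simp: bij_betw_def)
  have MA: "x \<in> A" "y \<in> A" "z \<in> A" if "(x, y, z) \<in> M" for x y z
    using M that by auto
  have D_iff: "(y, \<alpha> x, z) \<in> D \<longleftrightarrow> (x, y, z) \<in> M" if "x \<in> A" for x y z
    using that MA \<alpha>_inj unfolding D_def by blast
  \<comment> \<open>Write \<open>w\<close> as \<open>\<alpha> x\<close> and rotate
    \<open>(x, y, z)\<close> into \<open>(y, \<alpha> z, w)\<close>. The conjunct
    \<open>z \<in> A\<close> is stated because \<open>\<alpha>\<close> may send points outside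
    \<open>A\<close> into \<open>A\<close>.\<close>
  have D_iff': "(y, w, z) \<in> D \<longleftrightarrow> z \<in> A \<and> (y, \<alpha> z, w) \<in> M" for w y z
    using MA \<alpha>_surj[of w] D_iff rotate \<alpha>A unfolding D_def by blast
  have DA: "x \<in> A" "y \<in> A" "z \<in> A" if "(x, y, z) \<in> D" for x y z
    using that MA \<alpha>A unfolding D_def by auto
  have counit_left: "(\<exists>e\<in>E. (x, \<alpha> e, z) \<in> D) \<longleftrightarrow> x = z" if "x \<in> A" "z \<in> A" for x z
    using unit_left[OF that] D_iff E by blast
  have counit_right: "(\<exists>e\<in>E. (x, z, \<alpha> e) \<in> D) \<longleftrightarrow> x = z" if "x \<in> A" "z \<in> A" for x z
  proof -
    \<comment> \<open>By \<open>D_iff\<close> the left side becomes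
      \<open>(z', \<alpha> x', \<alpha> e) \<in> M\<close>, the rotation of
      \<open>(e, z', x')\<close>. So this counit law is the left unit law for the preimages.\<close>
    obtain x' z' where x': "x' \<in> A" "x = \<alpha> x'" and z': "z' \<in> A" "z = \<alpha> z'"
      using \<alpha>_surj[OF \<open>x \<in> A\<close>] \<alpha>_surj[OF \<open>z \<in> A\<close>] by blast
    have "(x, z, \<alpha> e) \<in> D \<longleftrightarrow> (e, z', x') \<in> M" if "e \<in> E" for e
      using that E D_iff[OF z'(1), of x "\<alpha> e"] rotate[of e z' x'] x' z' by auto
    then show ?thesis
      using unit_left[OF z'(1) x'(1)] \<alpha>_inj x' z' by blast
  qed
  have frob_left: "(\<exists>c. (x, a, c) \<in> D \<and> (c, y, b) \<in> M) \<longleftrightarrow> (\<exists>m. (x, y, m) \<in> M \<and> (m, a, b) \<in> D)"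
    for x y a b
  proof (cases "a \<in> A")
    case True
    \<comment> \<open>The output \<open>a\<close> of \<open>D\<close> turns into left multiplication
      by \<open>a'\<close>: both sides say that \<open>b\<close> is a value of the product of
      \<open>a'\<close>, \<open>x\<close> and \<open>y\<close>.\<close>
    then obtain a' where "a' \<in> A" "a = \<alpha> a'" using \<alpha>_surj by blast
    then show ?thesis using assoc[of a' x y b] D_iff by simp
  \<comment> \<open>Outside \<open>A\<close> both sides fail, since \<open>D\<close> only relates
    elements of \<open>A\<close>.\<close>
  qed (use DA in blast)
  have frob_right: "(\<exists>c. (y, c, b) \<in> D \<and> (x, c, a) \<in> M) \<longleftrightarrow> (\<exists>m. (x, y, m) \<in> M \<and> (m, a, b) \<in> D)"
    for x y a b
    \<comment> \<open>For \<open>b \<in> A\<close> the output \<open>b\<close> of \<open>D\<close>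
      turns into right multiplication by \<open>\<alpha> b\<close>: both sides say that
      \<open>a\<close> is a value of the product of \<open>x\<close>, \<open>y\<close> and
      \<open>\<alpha> b\<close>.\<close>
    using assoc[of x y "\<alpha> b" a] by (auto simp: D_iff')
  have comult_mult_iff: "((x, y), (a, b)) \<in> D \<circ>\<^sub>R as_mult M \<longleftrightarrow>
      (\<exists>m. (x, y, m) \<in> M \<and> (m, a, b) \<in> D)" for x y a b
    by (simp add: relcomp_unfold as_morphism_iff)
  show ?thesis
  proof
    show "as_counit (\<alpha> ` E) \<in> rel_hom A {()}"
      using E \<alpha>A by (auto simp: as_counit_def rel_hom_def)
    show "as_unit E \<in> rel_hom {()} A"
      using E by (auto simp: as_unit_def rel_hom_def)
    show "D \<in> rel_hom A (A \<times> A)"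
      using DA by (auto simp: rel_hom_def)
    show "as_mult M \<in> rel_hom (A \<times> A) A"
      using MA by (auto simp: rel_hom_def as_mult_def)
    \<comment> \<open>Here and below the composites are unfolded into coordinates; \<open>MA\<close>
      and \<open>DA\<close> supply the carrier conditions imposed by the identity and coherence
      relations.\<close>
    have "(x, z) \<in> as_mult M \<circ>\<^sub>R (as_unit E \<times>\<^sub>R Id_on A) \<circ>\<^sub>R (lunit A)\<inverse> \<longleftrightarrow>
        x \<in> A \<and> z \<in> A \<and> (\<exists>e\<in>E. (e, x, z) \<in> M)" for x z
      using MA DA by (auto simp: relcomp_unfold rel_times_iff rel_coherence_iff as_morphism_iff Id_on_iff)
    then show "as_mult M \<circ>\<^sub>R (as_unit E \<times>\<^sub>R Id_on A) \<circ>\<^sub>R (lunit A)\<inverse> = Id_on A"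
      using unit_left by (simp add: set_eq_iff Id_on_iff cong: conj_cong) blast
    have "(x, z) \<in> as_mult M \<circ>\<^sub>R (Id_on A \<times>\<^sub>R as_unit E) \<circ>\<^sub>R (runit A)\<inverse> \<longleftrightarrow>
        x \<in> A \<and> z \<in> A \<and> (\<exists>e\<in>E. (x, e, z) \<in> M)" for x z
      using MA DA by (auto simp: relcomp_unfold rel_times_iff rel_coherence_iff as_morphism_iff Id_on_iff)
    then show "as_mult M \<circ>\<^sub>R (Id_on A \<times>\<^sub>R as_unit E) \<circ>\<^sub>R (runit A)\<inverse> = Id_on A"
      using unit_right by (simp add: set_eq_iff Id_on_iff cong: conj_cong) blast
    have "(x, z) \<in> lunit A \<circ>\<^sub>R (as_counit (\<alpha> ` E) \<times>\<^sub>R Id_on A) \<circ>\<^sub>R D \<longleftrightarrow>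
        x \<in> A \<and> z \<in> A \<and> (\<exists>e\<in>E. (x, \<alpha> e, z) \<in> D)" for x z
      using MA DA by (auto simp: relcomp_unfold rel_times_iff rel_coherence_iff as_morphism_iff Id_on_iff)
    then show "lunit A \<circ>\<^sub>R (as_counit (\<alpha> ` E) \<times>\<^sub>R Id_on A) \<circ>\<^sub>R D = Id_on A"
      using counit_left by (simp add: set_eq_iff Id_on_iff cong: conj_cong) blast
    have "(x, z) \<in> runit A \<circ>\<^sub>R (Id_on A \<times>\<^sub>R as_counit (\<alpha> ` E)) \<circ>\<^sub>R D \<longleftrightarrow>
        x \<in> A \<and> z \<in> A \<and> (\<exists>e\<in>E. (x, z, \<alpha> e) \<in> D)" for x z
      using MA DA by (auto simp: relcomp_unfold rel_times_iff rel_coherence_iff as_morphism_iff Id_on_iff)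
    then show "runit A \<circ>\<^sub>R (Id_on A \<times>\<^sub>R as_counit (\<alpha> ` E)) \<circ>\<^sub>R D = Id_on A"
      using counit_right by (simp add: set_eq_iff Id_on_iff cong: conj_cong) blast
    have "((x, y), (a, b)) \<in> (Id_on A \<times>\<^sub>R as_mult M) \<circ>\<^sub>R assoc A \<circ>\<^sub>R (D \<times>\<^sub>R Id_on A) \<longleftrightarrow>
        (\<exists>c. (x, a, c) \<in> D \<and> (c, y, b) \<in> M)" for x y a b
      using MA DA by (auto simp: relcomp_unfold rel_times_iff rel_coherence_iff as_morphism_iff Id_on_iff)
    then show "(Id_on A \<times>\<^sub>R as_mult M) \<circ>\<^sub>R assoc A \<circ>\<^sub>R (D \<times>\<^sub>R Id_on A) = D \<circ>\<^sub>R as_mult M"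
      by (simp add: set_eq_iff frob_left comult_mult_iff)
    have "((x, y), (a, b)) \<in> (as_mult M \<times>\<^sub>R Id_on A) \<circ>\<^sub>R (assoc A)\<inverse> \<circ>\<^sub>R (Id_on A \<times>\<^sub>R D) \<longleftrightarrow>
        (\<exists>c. (y, c, b) \<in> D \<and> (x, c, a) \<in> M)" for x y a b
      using MA DA by (auto simp: relcomp_unfold rel_times_iff rel_coherence_iff as_morphism_iff Id_on_iff)
    then show "(as_mult M \<times>\<^sub>R Id_on A) \<circ>\<^sub>R (assoc A)\<inverse> \<circ>\<^sub>R (Id_on A \<times>\<^sub>R D) = D \<circ>\<^sub>R as_mult M"
      by (simp add: set_eq_iff frob_right comult_mult_iff)
  qed
qed

text \<open>The exponents 1 and -1 give the two directions. The negative one matters: invariance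
  under natural powers alone would allow \<open>f\<close> to map \<open>T\<close> properly into
  itself.\<close>

lemma int_invariant_iff:
  assumes "int_invariant A f T" "bij_betw f A A" "t \<in> A"
  shows "f t \<in> T \<longleftrightarrow> t \<in> T"
proof
  assume "t \<in> T"
  then have "int_power_on A f 1 t \<in> T"
    using assms(1) unfolding int_invariant_def by blast
  then show "f t \<in> T" by (simp add: int_power_on_def)
next
  assume "f t \<in> T"
  then have "int_power_on A f (- 1) (f t) \<in> T"
    using assms(1) unfolding int_invariant_def by blast
  then show "t \<in> T"
    using assms(2,3) by (simp add: int_power_on_def bij_betw_def)
qed

lemma bij_betw_rotate_triple:
  assumes "bij_betw \<alpha> A A"
  shows "bij_betw (rotate_triple \<alpha>) (A \<times> A \<times> A) (A \<times> A \<times> A)"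
  using assms bij_betw_inv_into_left[OF assms] bij_betw_inv_into_right[OF assms]
    bij_betw_apply[OF assms] bij_betw_apply[OF bij_betw_inv_into[OF assms]]
  \<comment> \<open>The witness solves \<open>(x, y, z) = (b, \<alpha> c, \<alpha> a)\<close> for
    \<open>(a, b, c)\<close>.\<close>
  by (intro bij_betw_byWitness[where f' = "\<lambda>(x, y, z). (inv_into A \<alpha> z, x, inv_into A \<alpha> y)"])
    (auto simp: rotate_triple_def)

context simplicial_set
begin

lemma edges_in: "\<zeta> \<in> X 2 \<Longrightarrow> edges d \<zeta> \<in> X 1 \<times> X 1 \<times> X 1"
  using face_closed[of 2 _ \<zeta>] by (simp add: edges_def)

text \<open>Repeating the first or the last vertex of the edge \<open>x\<close> gives a triangle
  with one degenerate side, at the source or the target of \<open>x\<close>. These triangles witness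
  the unit laws.\<close>

lemma edges_degen:
  assumes "x \<in> X 1"
  shows "edges d (s 1 0 x) = (s 0 0 (d 1 1 x), x, x)"
    and "edges d (s 1 1 x) = (x, s 0 0 (d 1 0 x), x)"
  using assms face_degen_id[of 0 0 1 x] face_degen_id[of 1 0 1 x] face_degen_greater[of 0 2 1 x]
    face_degen_id[of 1 1 1 x] face_degen_id[of 2 1 1 x] face_degen_less[of 0 1 1 x]
  by (simp_all add: edges_def numeral_2_eq_2)

text \<open>Face \<open>i\<close> omits vertex \<open>i\<close>. The six identities for iterated
  faces say that any two faces share an edge, so the twelve entries reduce to six edges, named by
  their end vertices.\<close>

lemma tetrahedron_edges:
  assumes "\<gamma> \<in> X 3"
  obtains e01 e02 e03 e12 e13 e23 where
    "edges d (d 3 0 \<gamma>) = (e12, e23, e13)" "edges d (d 3 1 \<gamma>) = (e02, e23, e03)"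
    "edges d (d 3 2 \<gamma>) = (e01, e13, e03)" "edges d (d 3 3 \<gamma>) = (e01, e12, e02)"
  using assms face_face[of 3 0 1 \<gamma>] face_face[of 3 0 2 \<gamma>] face_face[of 3 0 3 \<gamma>]
    face_face[of 3 1 2 \<gamma>] face_face[of 3 1 3 \<gamma>] face_face[of 3 2 3 \<gamma>]
  by (simp add: edges_def)

text \<open>Two triangles sharing the intermediate product as an edge are faces of a 3-simplex; the
  other two faces give the other bracketing, with the opposite edge as intermediate product. The
  shared edge is 02 for (B2) and 13 for (B1).\<close>

lemma edges_assoc:
  assumes B1: "\<And>\<zeta>\<^sub>0 \<zeta>\<^sub>2. \<lbrakk>\<zeta>\<^sub>0 \<in> X 2; \<zeta>\<^sub>2 \<in> X 2; d 2 0 \<zeta>\<^sub>2 = d 2 1 \<zeta>\<^sub>0\<rbrakk> \<Longrightarrow>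
          \<exists>\<gamma> \<in> X 3. d 3 0 \<gamma> = \<zeta>\<^sub>0 \<and> d 3 2 \<gamma> = \<zeta>\<^sub>2"
    and B2: "\<And>\<zeta>\<^sub>1 \<zeta>\<^sub>3. \<lbrakk>\<zeta>\<^sub>1 \<in> X 2; \<zeta>\<^sub>3 \<in> X 2; d 2 1 \<zeta>\<^sub>3 = d 2 2 \<zeta>\<^sub>1\<rbrakk> \<Longrightarrow>
          \<exists>\<gamma> \<in> X 3. d 3 1 \<gamma> = \<zeta>\<^sub>1 \<and> d 3 3 \<gamma> = \<zeta>\<^sub>3"
  defines "M \<equiv> edges d ` X 2"
  shows "(\<exists>u. (x, y, u) \<in> M \<and> (u, z, w) \<in> M) \<longleftrightarrow> (\<exists>v. (y, z, v) \<in> M \<and> (x, v, w) \<in> M)"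
proof -
  have face: "edges d (d 3 i \<gamma>) \<in> M" if "\<gamma> \<in> X 3" "i \<le> 3" for \<gamma> i
    using face_closed[of 3 i \<gamma>] that by (simp add: M_def)
  show ?thesis
  proof
    assume "\<exists>u. (x, y, u) \<in> M \<and> (u, z, w) \<in> M"
    then obtain u \<zeta>\<^sub>3 \<zeta>\<^sub>1 where \<zeta>: "\<zeta>\<^sub>3 \<in> X 2" "(x, y, u) = edges d \<zeta>\<^sub>3"
      "\<zeta>\<^sub>1 \<in> X 2" "(u, z, w) = edges d \<zeta>\<^sub>1"
      unfolding M_def by (elim exE conjE imageE)
    then obtain \<gamma> where \<gamma>: "\<gamma> \<in> X 3" "d 3 1 \<gamma> = \<zeta>\<^sub>1" "d 3 3 \<gamma> = \<zeta>\<^sub>3"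
      using B2[of \<zeta>\<^sub>1 \<zeta>\<^sub>3] by (auto simp: edges_def)
    show "\<exists>v. (y, z, v) \<in> M \<and> (x, v, w) \<in> M"
      by (rule tetrahedron_edges[OF \<gamma>(1)])
        (use face[OF \<gamma>(1), of 0] face[OF \<gamma>(1), of 2] \<gamma>(2,3) \<zeta>(2,4) in auto)
  next
    assume "\<exists>v. (y, z, v) \<in> M \<and> (x, v, w) \<in> M"
    then obtain v \<zeta>\<^sub>0 \<zeta>\<^sub>2 where \<zeta>: "\<zeta>\<^sub>0 \<in> X 2" "(y, z, v) = edges d \<zeta>\<^sub>0"
      "\<zeta>\<^sub>2 \<in> X 2" "(x, v, w) = edges d \<zeta>\<^sub>2"
      unfolding M_def by (elim exE conjE imageE)
    then obtain \<gamma> where \<gamma>: "\<gamma> \<in> X 3" "d 3 0 \<gamma> = \<zeta>\<^sub>0" "d 3 2 \<gamma> = \<zeta>\<^sub>2"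
      using B1[of \<zeta>\<^sub>0 \<zeta>\<^sub>2] by (auto simp: edges_def)
    show "\<exists>u. (x, y, u) \<in> M \<and> (u, z, w) \<in> M"
      by (rule tetrahedron_edges[OF \<gamma>(1)])
        (use face[OF \<gamma>(1), of 1] face[OF \<gamma>(1), of 3] \<gamma>(2,3) \<zeta>(2,4) in auto)
  qed
qed

end

theorem theorem5p6:
  fixes X :: "nat \<Rightarrow> 'a set"
    and d s :: "nat \<Rightarrow> nat \<Rightarrow> 'a \<Rightarrow> 'a"
    and \<alpha> :: "'a \<Rightarrow> 'a"
    and \<epsilon> \<eta> :: "'a set"
    and \<delta> \<mu> :: "('a \<times> 'a \<times> 'a) set"
  assumes simplicial: "simplicial_set X d s"
    and coskeletal: "two_coskeletal X d"
    and bij: "bij_betw \<alpha> (X 1) (X 1)"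
    and A1: "inj_on (edges d) (X 2)"
    and A2: "\<And>\<zeta>. \<zeta> \<in> X 2 \<Longrightarrow>
          ((\<exists>u \<in> X 0. d 2 0 \<zeta> = s 0 0 u) \<longrightarrow> d 2 2 \<zeta> = d 2 1 \<zeta>) \<and>
          ((\<exists>u \<in> X 0. d 2 2 \<zeta> = s 0 0 u) \<longrightarrow> d 2 0 \<zeta> = d 2 1 \<zeta>)"
    and B1: "\<And>\<zeta>\<^sub>0 \<zeta>\<^sub>2. \<lbrakk>\<zeta>\<^sub>0 \<in> X 2; \<zeta>\<^sub>2 \<in> X 2; d 2 0 \<zeta>\<^sub>2 = d 2 1 \<zeta>\<^sub>0\<rbrakk> \<Longrightarrow>
          \<exists>\<gamma> \<in> X 3. d 3 0 \<gamma> = \<zeta>\<^sub>0 \<and> d 3 2 \<gamma> = \<zeta>\<^sub>2"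
    and B2: "\<And>\<zeta>\<^sub>1 \<zeta>\<^sub>3. \<lbrakk>\<zeta>\<^sub>1 \<in> X 2; \<zeta>\<^sub>3 \<in> X 2; d 2 1 \<zeta>\<^sub>3 = d 2 2 \<zeta>\<^sub>1\<rbrakk> \<Longrightarrow>
          \<exists>\<gamma> \<in> X 3. d 3 1 \<gamma> = \<zeta>\<^sub>1 \<and> d 3 3 \<gamma> = \<zeta>\<^sub>3"
    and C: "int_invariant (X 1 \<times> X 1 \<times> X 1) (rotate_triple \<alpha>) (edges d ` X 2)"
    and mu: "\<mu> = edges d ` X 2"
    and eta: "\<eta> = s 0 0 ` X 0"
    and eps: "\<epsilon> = (\<alpha> \<circ> s 0 0) ` X 0"
    and delta: "\<delta> = {(y, \<alpha> x, z) | x y z. (x, y, z) \<in> \<mu>}"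
  shows "frobenius_object_Rel (X 1) (as_counit \<epsilon>) (as_unit \<eta>) \<delta> (as_mult \<mu>)"
proof -
  interpret simplicial_set X d s by (rule simplicial)
  let ?A = "X 1" and ?E = "s 0 0 ` X 0" and ?M = "edges d ` X 2"
  have E: "?E \<subseteq> ?A"
    using degen_closed[of 0 0] by auto
  have M: "?M \<subseteq> ?A \<times> ?A \<times> ?A"
    using edges_in by blast
  have degen: "s 1 i x \<in> X 2" if "x \<in> ?A" "i \<le> 1" for i x
    using degen_closed[of i 1 x] that by (simp add: numeral_2_eq_2)
  have face: "d 1 i x \<in> X 0" if "x \<in> ?A" "i \<le> 1" for i x
    using face_closed[of 1 i x] that by simp
  have unit_left: "(\<exists>e\<in>?E. (e, x, z) \<in> ?M) \<longleftrightarrow> x = z" if "x \<in> ?A" "z \<in> ?A" for x z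
  proof
    assume "\<exists>e\<in>?E. (e, x, z) \<in> ?M"
    \<comment> \<open>The side \<open>d 2 2\<close> is degenerate, so (A2) equates the sides
      \<open>d 2 0\<close> and \<open>d 2 1\<close>.\<close>
    then show "x = z" using A2 by (fastforce simp: edges_def)
  next
    assume "x = z"
    then show "\<exists>e\<in>?E. (e, x, z) \<in> ?M"
      using edges_degen(1)[of x] degen[of x 0] face[of x 1] that by (metis imageI le_refl zero_le)
  qed
  have unit_right: "(\<exists>e\<in>?E. (x, e, z) \<in> ?M) \<longleftrightarrow> x = z" if "x \<in> ?A" "z \<in> ?A" for x z
  proof
    assume "\<exists>e\<in>?E. (x, e, z) \<in> ?M"
    then show "x = z" using A2 by (fastforce simp: edges_def)
  next
    assume "x = z"
    \<comment> \<open>The right unit of \<open>x\<close> sits at its target \<open>d 1 0 x\<close>,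
      by way of the triangle \<open>s 1 1 x\<close>; the left unit above sits at its source.\<close>
    then show "\<exists>e\<in>?E. (x, e, z) \<in> ?M"
      using edges_degen(2)[of x] degen[of x 1] face[of x 0] that by (metis imageI le_refl zero_le)
  qed
  have rotate: "(y, \<alpha> z, \<alpha> x) \<in> ?M \<longleftrightarrow> (x, y, z) \<in> ?M"
    if "x \<in> ?A" "y \<in> ?A" "z \<in> ?A" for x y z
    using int_invariant_iff[OF C bij_betw_rotate_triple[OF bij], of "(x, y, z)"] that
    by (simp add: rotate_triple_def)
  have "frobenius_object_Rel ?A (as_counit (\<alpha> ` ?E)) (as_unit ?E)
      {(y, \<alpha> x, z) | x y z. (x, y, z) \<in> ?M} (as_mult ?M)"
    using M E bij unit_left unit_right edges_assoc[OF B1 B2] rotate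
    by (rule frobenius_object_of_rotation_invariant_monoid)
  then show ?thesis
    by (simp only: mu eta eps delta image_comp)
qed

end
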